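(* Let $D$ be a skew shape and let $n\ge1$ be an integer. There exist integers $p,m_0\ge1$ and a $321$-avoiding permutation $w\in S_p$ such that, for every integer $m\ge m_0$, one has $$s_D(x_1,\ldots,x_n)=\mathfrak S_{\mathrm{id}_m\times w}(x_1,\ldots,x_n,0,\ldots,0),$$ where the variables of the Schubert polynomial $\mathfrak S_{\mathrm{id}_m\times w}$ are $z_1,\ldots,z_{m+p-1}$ (with $m+p-1\ge n$), and the right-hand side is obtained by setting $z_i=x_i$ for $1\le i\le n$ and $z_i=0$ for $n<i\le m+p-1$.
   Context: A skew shape is $D=\lambda/\mu$ for partitions $\mu\subseteq\lambda$ (i.e. $\mu_i\le\lambda_i$ for all $i$, partitions being extended by zeros): the set of boxes $(i,j)$ with $i\ge 1$ and $\mu_i<j\le\lambda_i$ (English notation: rows $i$ numbered from top to bottom, columns $j$ from left to right). A semistandard tableau of shape $D$ is a filling of the boxes of $D$ by positive integers, weakly increasing along rows and strictly increasing down columns. The skew Schur polynomial is $s_D(x_1,\ldots,x_n)=\sum_T x_1^{m_1(T)}\cdots x_n^{m_n(T)}$, where $T$ ranges over semistandard tableaux of shape $D$ with entries in $\{1,\ldots,n\}$ and $m_i(T)$ is the number of entries of $T$ equal to $i$ (so $s_D=1$ if $D$ is empty, and $s_D=0$ if no such tableaux exist). Permutations are written in one-line notation. A permutation $w=(w_1,\ldots,w_p)\in S_p$ is $321$-avoiding if there are no indices $i<j<k$ with $w_i>w_j>w_k$. For $u=(u_1,\ldots,u_a)\in S_a$ and $v=(v_1,\ldots,v_b)\in S_b$,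 $u\times v=(u_1,\ldots,u_a,v_1+a,\ldots,v_b+a)\in S_{a+b}$; $\mathrm{id}_m$ is the identity of $S_m$. $\mathfrak S_w$ denotes the usual Schubert polynomial: for the longest element $w_0\in S_q$, $\mathfrak S_{w_0}=z_1^{q-1}z_2^{q-2}\cdots z_{q-1}$, and if $w\in S_q$ and $w_i>w_{i+1}$, then $\mathfrak S_{ws_i}=\partial_i\mathfrak S_w$, where $ws_i$ is obtained from $w$ by exchanging the entries in positions $i$ and $i+1$ and $\partial_i f=\dfrac{f-f|_{z_i\leftrightarrow z_{i+1}}}{z_i-z_{i+1}}$. For $w\in S_q$ the polynomial $\mathfrak S_w$ involves only $z_1,\ldots,z_{q-1}$. *)

theory Defs
  imports
    "HOL-Library.Poly_Mapping"
    "HOL-Library.FuncSet"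
    "HOL-Combinatorics.Permutations"
begin

section \<open>Polynomials\<close>

text \<open>
  Polynomials with integer coefficients in countably many variables: an exponent vector is a
  finitely supported function from variable indices to exponents. The ring structure (an integral
  domain) is that of \<^theory>\<open>HOL-Library.Poly_Mapping\<close>. Variables are numbered from 1.
\<close>

type_synonym ipoly = "(nat \<Rightarrow>\<^sub>0 nat) \<Rightarrow>\<^sub>0 int"

definition Var :: "nat \<Rightarrow> ipoly" where
  "Var i = Poly_Mapping.single (Poly_Mapping.single i 1) 1"

definition subst :: "(nat \<Rightarrow> ipoly) \<Rightarrow> ipoly \<Rightarrow> ipoly" where
  "subst \<sigma> f =
     (\<Sum>e\<in>Poly_Mapping.keys f. of_int (Poly_Mapping.lookup f e) *
        (\<Prod>i\<in>Poly_Mapping.keys e. \<sigma> i ^ Poly_Mapping.lookup e i))"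


section \<open>Skew shapes and skew Schur polynomials\<close>

text \<open>Partitions are indexed from 1; the value at 0 is irrelevant.\<close>

definition is_partition :: "(nat \<Rightarrow> nat) \<Rightarrow> bool" where
  "is_partition lam \<longleftrightarrow> antimono_on {1..} lam \<and> finite {i. 1 \<le> i \<and> lam i \<noteq> 0}"

definition skew_boxes :: "(nat \<Rightarrow> nat) \<Rightarrow> (nat \<Rightarrow> nat) \<Rightarrow> (nat \<times> nat) set" where
  "skew_boxes lam mu = {(i, j). 1 \<le> i \<and> mu i < j \<and> j \<le> lam i}"

definition is_skew_shape :: "(nat \<times> nat) set \<Rightarrow> bool" where
  "is_skew_shape D \<longleftrightarrow>
     (\<exists>lam mu. is_partition lam \<and> is_partition mu \<and> (\<forall>i\<ge>1. mu i \<le> lam i) \<and>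
        D = skew_boxes lam mu)"

text \<open>Fillings are \<^const>\<open>extensional\<close>, so that each tableau is represented by exactly one function.\<close>

definition ssyt :: "(nat \<times> nat) set \<Rightarrow> nat \<Rightarrow> (nat \<times> nat \<Rightarrow> nat) set" where
  "ssyt D n =
     {T \<in> D \<rightarrow>\<^sub>E {1..n}.
        (\<forall>i j j'. (i, j) \<in> D \<and> (i, j') \<in> D \<and> j < j' \<longrightarrow> T (i, j) \<le> T (i, j')) \<and>
        (\<forall>i i' j. (i, j) \<in> D \<and> (i', j) \<in> D \<and> i < i' \<longrightarrow> T (i, j) < T (i', j))}"

definition skew_schur :: "(nat \<times> nat) set \<Rightarrow> nat \<Rightarrow> ipoly" where
  "skew_schur D n = (\<Sum>T\<in>ssyt D n. \<Prod>i\<in>{1..n}. Var i ^ card {b \<in> D. T b = i})"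


section \<open>Permutations\<close>

text \<open>
  An element of \<open>S\<^sub>p\<close> is a function \<open>w\<close> on \<^typ>\<open>nat\<close> such that \<open>w permutes {1..p}\<close>; its one-line
  notation is \<open>(w 1, \<dots>, w p)\<close>.
\<close>

definition avoids_321 :: "nat \<Rightarrow> (nat \<Rightarrow> nat) \<Rightarrow> bool" where
  "avoids_321 p w \<longleftrightarrow>
     \<not> (\<exists>i j k. 1 \<le> i \<and> i < j \<and> j < k \<and> k \<le> p \<and> w i > w j \<and> w j > w k)"

text \<open>
  The product \<open>u \<times> v\<close> for \<open>u \<in> S\<^sub>a\<close>. The degree of \<open>v\<close> is not needed as a parameter, because \<open>v\<close>
  fixes everything beyond it.
\<close>

definition perm_times :: "nat \<Rightarrow> (nat \<Rightarrow> nat) \<Rightarrow> (nat \<Rightarrow> nat) \<Rightarrow> nat \<Rightarrow> nat" where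
  "perm_times a u v = (\<lambda>i. if i \<le> a then u i else v (i - a) + a)"

definition longest_perm :: "nat \<Rightarrow> nat \<Rightarrow> nat" where
  "longest_perm q = (\<lambda>i. if i \<in> {1..q} then q + 1 - i else i)"


section \<open>Schubert polynomials\<close>

text \<open>The quotient exists and is unique for every \<open>f\<close>, the polynomial ring being a domain.\<close>

definition divided_difference :: "nat \<Rightarrow> ipoly \<Rightarrow> ipoly" where
  "divided_difference i f =
     (THE g. (Var i - Var (i + 1)) * g = f - subst (Var \<circ> Transposition.transpose i (i + 1)) f)"

text \<open>
  \<open>is_schubert q w f\<close> holds iff \<open>f\<close> is obtained from the polynomial of the longest element of
  \<open>S\<^sub>q\<close> by applying divided differences along some chain of descents ending in \<open>w\<close>. That \<open>f\<close> does
  not depend on the chain is the classical well-definedness of Schubert polynomials.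
  Composing with a transposition on the right exchanges two positions in one-line notation.
\<close>

inductive is_schubert :: "nat \<Rightarrow> (nat \<Rightarrow> nat) \<Rightarrow> ipoly \<Rightarrow> bool" for q :: nat where
  longest: "is_schubert q (longest_perm q) (\<Prod>i\<in>{1..<q}. Var i ^ (q - i))"
| descent: "is_schubert q w f \<Longrightarrow> 1 \<le> i \<Longrightarrow> i < q \<Longrightarrow> w i > w (i + 1) \<Longrightarrow>
    is_schubert q (w \<circ> Transposition.transpose i (i + 1)) (divided_difference i f)"

definition schubert :: "nat \<Rightarrow> (nat \<Rightarrow> nat) \<Rightarrow> ipoly" where
  "schubert q w = (THE f. is_schubert q w f)"

end

theory Submission
  imports Defs
begin

text \<open>
  By Fomin and Kirillov, the Schubert polynomials of \<open>S\<^sub>q\<close> are the coefficients of a product of linear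
  factors \<open>1 + x\<^sub>i u\<^sub>j\<close> over the nilCoxeter algebra: this product satisfies \<open>\<partial>\<^sub>i F = F u\<^sub>i\<close>, which settles
  all chains of descents at once. Setting \<open>x\<^sub>i = 0\<close> for \<open>i > n\<close> and looking at the coefficient of
  \<open>id\<^sub>m \<times> w\<close> with \<open>m \<ge> n\<close>, only the generators beyond \<open>m\<close> matter, and the first \<open>n\<close> rows of the product
  become copies of one and the same decreasing product. For \<open>D = \<lambda>/\<mu>\<close> let \<open>w\<close> send the position of each
  step of the boundary path of \<open>\<lambda>\<close> to its position in the boundary path of \<open>\<mu>\<close>. The descents of \<open>w\<close> are
  the corners of \<open>\<lambda>\<close> outside \<open>\<mu>\<close>, and right multiplication by the corresponding transposition removes
  the corner; hence each decreasing product removes a horizontal strip, namely the boxes filled with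
  the largest entry of a semistandard tableau.
\<close>

section \<open>Substitution homomorphisms\<close>

definition subst_monom :: "(nat \<Rightarrow> ipoly) \<Rightarrow> (nat \<Rightarrow>\<^sub>0 nat) \<Rightarrow> ipoly" where
  "subst_monom \<sigma> e = (\<Prod>i\<in>Poly_Mapping.keys e. \<sigma> i ^ Poly_Mapping.lookup e i)"

lemma subst_monom_add: "subst_monom \<sigma> (d + e) = subst_monom \<sigma> d * subst_monom \<sigma> e"
proof -
  let ?K = "Poly_Mapping.keys d \<union> Poly_Mapping.keys e"
  have *: "subst_monom \<sigma> a = (\<Prod>i\<in>?K. \<sigma> i ^ Poly_Mapping.lookup a i)"
    if "Poly_Mapping.keys a \<subseteq> ?K" for a
    unfolding subst_monom_def using that
    by (intro prod.mono_neutral_left) (auto simp: in_keys_iff)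
  show ?thesis
    by (subst (1 2 3) *)
      (auto simp: lookup_add power_add prod.distrib Poly_Mapping.keys_add in_keys_iff)
qed

lemma frag_cmul_right_diff_distrib: "frag_cmul c (a - b) = frag_cmul c a - frag_cmul c b"
  by (rule poly_mapping_eqI) (simp add: lookup_minus right_diff_distrib)

lemma frag_cmul_eq_of_int: "frag_cmul c (f :: ipoly) = of_int c * f"
proof (induction f rule: frag_induction[OF subset_UNIV])
  case (2 x)
  have "frag_cmul c (frag_of x) = Poly_Mapping.single x c"
    by (rule poly_mapping_eqI) (simp add: lookup_single)
  then show ?case
    by (simp add: mult_single flip: single_of_int)
qed (simp_all add: frag_cmul_right_diff_distrib right_diff_distrib)

text \<open>Polynomials form the free abelian group on exponent vectors. Seen as a linear extension,
  \<open>subst\<close> inherits additivity, and \<open>frag_induction\<close> reduces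
  multiplicativity to monomials.\<close>

lemma subst_eq_frag_extend: "subst \<sigma> f = frag_extend (subst_monom \<sigma>) f"
  by (simp add: subst_def frag_extend_def subst_monom_def frag_cmul_eq_of_int)

lemma subst_add: "subst \<sigma> (f + g) = subst \<sigma> f + subst \<sigma> g"
  and subst_diff: "subst \<sigma> (f - g) = subst \<sigma> f - subst \<sigma> g"
  and subst_uminus: "subst \<sigma> (- f) = - subst \<sigma> f"
  and subst_zero: "subst \<sigma> 0 = 0"
  by (simp_all add: subst_eq_frag_extend frag_extend_add frag_extend_diff frag_extend_minus)

lemma frag_of_mult: "frag_of d * frag_of e = (frag_of (d + e) :: ipoly)"
  by (simp add: mult_single)

lemma subst_frag_of: "subst \<sigma> (frag_of e) = subst_monom \<sigma> e"
  by (simp add: subst_eq_frag_extend)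

lemma subst_mult: "subst \<sigma> (f * g) = subst \<sigma> f * subst \<sigma> g"
proof -
  have *: "subst \<sigma> (frag_of e * g) = subst_monom \<sigma> e * subst \<sigma> g" for e
  proof (induction g rule: frag_induction[OF subset_UNIV])
    case (2 x)
    then show ?case
      by (simp add: frag_of_mult subst_frag_of subst_monom_add)
  qed (simp_all add: subst_zero subst_diff right_diff_distrib)
  show ?thesis
    by (induction f rule: frag_induction[OF subset_UNIV])
      (simp_all add: * subst_zero subst_diff left_diff_distrib subst_frag_of)
qed

lemma subst_one: "subst \<sigma> 1 = 1"
  using subst_frag_of[of \<sigma> 0] by (simp add: subst_monom_def)

lemma subst_Var [simp]: "subst \<sigma> (Var i) = \<sigma> i"
proof -
  have "Var i = frag_of (Poly_Mapping.single i 1)" by (simp add: Var_def)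
  then show ?thesis by (simp add: subst_frag_of subst_monom_def)
qed

lemmas subst_simps = subst_add subst_diff subst_uminus subst_zero subst_mult subst_one

lemma Var_eq_iff: "Var i = Var j \<longleftrightarrow> i = j"
proof
  assume "Var i = Var j"
  then have "Poly_Mapping.single i (1::nat) = Poly_Mapping.single j 1"
    by (simp only: Var_def frag_of_eq)
  then have "Poly_Mapping.keys (Poly_Mapping.single i (1::nat)) = Poly_Mapping.keys (Poly_Mapping.single j (1::nat))"
    by simp
  then show "i = j" by simp
qed simp

section \<open>The nilCoxeter algebra acting on functions on permutations\<close>

text \<open>
  A function on permutations stands for the element of the nilCoxeter algebra having these
  coefficients; then \<open>nil j\<close> is right multiplication by the \<open>j\<close>-th generator.
\<close>

definition nil :: "nat \<Rightarrow> ((nat \<Rightarrow> nat) \<Rightarrow> ipoly) \<Rightarrow> (nat \<Rightarrow> nat) \<Rightarrow> ipoly" where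
  "nil j f = (\<lambda>w. if w j > w (j + 1) then f (w \<circ> Transposition.transpose j (j + 1)) else 0)"

definition fac :: "nat \<Rightarrow> ipoly \<Rightarrow> ((nat \<Rightarrow> nat) \<Rightarrow> ipoly) \<Rightarrow> (nat \<Rightarrow> nat) \<Rightarrow> ipoly" where
  "fac j x f = (\<lambda>w. f w + x * nil j f w)"

text \<open>Right multiplication by the product of \<open>1 + x u\<^sub>j\<close> for \<open>j = i + l - 1, \<dots>, i\<close> in this order.\<close>

fun row :: "nat \<Rightarrow> nat \<Rightarrow> ipoly \<Rightarrow> ((nat \<Rightarrow> nat) \<Rightarrow> ipoly) \<Rightarrow> (nat \<Rightarrow> nat) \<Rightarrow> ipoly" where
  "row i 0 x f = f"
| "row i (Suc l) x f = fac i x (row (Suc i) l x f)"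

section \<open>Relations between the nilCoxeter generators\<close>

lemma nil_add: "nil j (\<lambda>w. f w + g w) = (\<lambda>w. nil j f w + nil j g w)"
  and nil_cmult: "nil j (\<lambda>w. c * f w) = (\<lambda>w. c * nil j f w)"
  and nil_diff: "nil j (\<lambda>w. f w - g w) = (\<lambda>w. nil j f w - nil j g w)"
  by (auto simp: nil_def)

lemma nil_nil: "nil j (nil j f) = (\<lambda>w. 0)"
  by (auto simp: nil_def)

lemma nil_commute:
  assumes "i + 1 < j"
  shows "nil i (nil j f) = nil j (nil i f)"
proof
  fix w :: "nat \<Rightarrow> nat"
  have "w \<circ> Transposition.transpose i (Suc i) \<circ> Transposition.transpose j (Suc j)
      = w \<circ> Transposition.transpose j (Suc j) \<circ> Transposition.transpose i (Suc i)"
    using assms by (auto simp: fun_eq_iff Transposition.transpose_def)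
  then show "nil i (nil j f) w = nil j (nil i f) w"
    using assms by (auto simp: nil_def)
qed

text \<open>Both sides vanish unless \<open>w i > w (i + 1) > w (i + 2)\<close>, and then the braid
  relation of transpositions makes them evaluate \<open>f\<close> at the same permutation.\<close>

lemma nil_braid: "nil i (nil (Suc i) (nil i f)) = nil (Suc i) (nil i (nil (Suc i) f))"
proof
  fix w :: "nat \<Rightarrow> nat"
  let ?s = "Transposition.transpose i (Suc i)" and ?t = "Transposition.transpose (Suc i) (Suc (Suc i))"
  have "w \<circ> ?s \<circ> ?t \<circ> ?s = w \<circ> ?t \<circ> ?s \<circ> ?t"
    by (auto simp: fun_eq_iff Transposition.transpose_def)
  then show "nil i (nil (Suc i) (nil i f)) w = nil (Suc i) (nil i (nil (Suc i) f)) w"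
    by (auto simp: nil_def)
qed

lemma nil_zero: "nil j (\<lambda>w. 0) = (\<lambda>w. 0)"
  by (simp add: nil_def)

lemmas nil_linear = nil_add nil_cmult nil_diff

lemma nil_fac_commute:
  assumes "i + 1 < j"
  shows "nil i (fac j x f) = fac j x (nil i f)"
  unfolding fac_def nil_linear using nil_commute[OF assms] by simp

lemma nil_row_commute:
  assumes "i + 1 < j"
  shows "nil i (row j l x f) = row j l x (nil i f)"
  using assms by (induction l arbitrary: j) (simp_all add: nil_fac_commute)

lemma fac_row_commute:
  assumes "i + 1 < j"
  shows "fac i y (row j l x f) = row j l x (fac i y f)"
proof -
  have *: "fac i y (fac j x f) = fac j x (fac i y f)" if "i + 1 < j" for j f
    unfolding fac_def nil_linear using nil_commute[OF that, of f] by (simp add: fun_eq_iff algebra_simps)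
  show ?thesis
    using assms by (induction l arbitrary: j) (simp_all add: *)
qed

text \<open>Since \<open>nil i\<close> squares to zero, \<open>fac i (- x)\<close> undoes
  \<open>fac i x\<close>; this lets a row be lengthened or shortened at its outermost
  factor.\<close>

lemma fac_fac: "fac i x (fac i y f) = fac i (x + y) f"
  unfolding fac_def nil_linear nil_nil by (simp add: fun_eq_iff algebra_simps)

lemma fac_zero: "fac i 0 f = f"
  by (simp add: fac_def)

text \<open>Expanding with \<open>a\<^sup>2 = b\<^sup>2 = 0\<close> and \<open>aba = bab\<close> gives \<open>1 + (x + y) a + x y (b a - a b)\<close>, symmetric in \<open>x, y\<close>.\<close>

lemma fac_exchange:
  "fac i x (fac (Suc i) x (fac i y (fac (Suc i) (- x) f))) =
   fac i y (fac (Suc i) y (fac i x (fac (Suc i) (- y) f)))"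
proof -
  have "fac i x (fac (Suc i) x (fac i y (fac (Suc i) (- x) f))) = 
    (\<lambda>w. f w + (x + y) * nil i f w + x * y * (nil (Suc i) (nil i f) w - nil i (nil (Suc i) f) w))" for x y
    unfolding fac_def nil_linear nil_nil nil_braid
    by (simp add: nil_zero fun_eq_iff algebra_simps power2_eq_square)
  from this[of x y] this[of y x] show ?thesis
    by (simp only: add.commute mult.commute)
qed

text \<open>This is the source of all symmetry in the variables. The two rows are rearranged until
  the rows starting at \<open>i + 1\<close>, which commute by induction, stand innermost; the four
  factors left outside are handled by \<open>fac_exchange\<close>.\<close>

lemma row_commute: "row i l x (row i l y f) = row i l y (row i l x f)"
proof (induction l arbitrary: i f rule: induct_nat_012)
  case 0
  then show ?case by simp
next
  case 1
  then show ?case by (simp add: fac_fac add.commute)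
next
  case (ge2 l)
  have *: "row i (Suc (Suc l)) x (row i (Suc (Suc l)) y f) =
      fac i x (fac (Suc i) x (fac i y (fac (Suc i) (- x)
        (row (Suc i) (Suc l) x (row (Suc i) (Suc l) y f)))))" for x y
  proof -
    have "row i (Suc (Suc l)) x (row i (Suc (Suc l)) y f) =
      fac i x (fac (Suc i) x (fac i y (row (Suc (Suc i)) l x (row (Suc i) (Suc l) y f))))"
      by (simp add: fac_row_commute)
    \<comment> \<open>The row starting at \<open>i + 2\<close> is completed by the factor
      \<open>i + 1\<close>, at the price of the inverse factor in front.\<close>
    moreover have "row (Suc (Suc i)) l x g = fac (Suc i) (- x) (row (Suc i) (Suc l) x g)" for g
      by (simp add: fac_fac fac_zero)
    ultimately show ?thesis by (simp only:)
  qed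
  show ?case
    unfolding * by (subst ge2(2)) (rule fac_exchange)
qed

lemma fac_diff: "fac i x (\<lambda>w. f w - g w) = (\<lambda>w. fac i x f w - fac i x g w)"
  and fac_cmult: "fac i x (\<lambda>w. c * f w) = (\<lambda>w. c * fac i x f w)"
  unfolding fac_def nil_linear by (simp_all add: fun_eq_iff algebra_simps)

lemma row_diff: "row i l x (\<lambda>w. f w - g w) = (\<lambda>w. row i l x f w - row i l x g w)"
  and row_cmult: "row i l x (\<lambda>w. c * f w) = (\<lambda>w. c * row i l x f w)"
  by (induction l arbitrary: i) (simp_all add: fac_diff fac_cmult)

lemma subst_nil: "subst \<sigma> (nil j f w) = nil j (\<lambda>w. subst \<sigma> (f w)) w"
  by (simp add: nil_def subst_zero)

lemma subst_row: "subst \<sigma> (row i l x f w) = row i l (subst \<sigma> x) (\<lambda>w. subst \<sigma> (f w)) w"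
  by (induction l arbitrary: i w) (simp_all add: fac_def subst_simps subst_nil)

section \<open>The Fomin--Kirillov product\<close>

definition delta :: "(nat \<Rightarrow> nat) \<Rightarrow> ipoly" where
  "delta w = (if w = id then 1 else 0)"

lemma subst_delta: "subst \<sigma> (delta w) = delta w"
  by (simp add: delta_def subst_simps)

text \<open>Row \<open>k\<close> runs through the generators \<open>q - 1, ..., k\<close> with the
  variable \<open>Var k\<close>. Row \<open>q\<close> is empty, so \<open>fk q q\<close> is the
  whole product; the partial products serve in inductions over the rows.\<close>

fun fk :: "nat \<Rightarrow> nat \<Rightarrow> (nat \<Rightarrow> nat) \<Rightarrow> ipoly" where
  "fk q 0 = delta"
| "fk q (Suc k) = row (Suc k) (q - Suc k) (Var (Suc k)) (fk q k)"

text \<open>Only variables up to \<open>k\<close> occur in the first \<open>k\<close> rows.\<close>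

lemma fk_swap_invariant:
  assumes "k < i"
  shows "subst (Var \<circ> Transposition.transpose i (i + 1)) (fk q k w) = fk q k w"
  using assms
proof (induction k arbitrary: w)
  case 0
  then show ?case by (simp add: subst_delta)
next
  case (Suc k)
  then show ?case by (simp add: subst_row Transposition.transpose_def)
qed

text \<open>Of the variables \<open>x = Var i\<close> and \<open>y = Var (i + 1)\<close>, each
  occurs in just one row. Lengthening row \<open>i + 1\<close> by the factor \<open>i\<close> gives
  a product \<open>P\<close> of two rows over the same generators, which is symmetric in
  \<open>x\<close> and \<open>y\<close>. The product up to row \<open>i + 1\<close> is thus
  \<open>P (1 - y u)\<close> with \<open>u\<close> the generator \<open>i\<close>, its image under
  the swap is \<open>P (1 - x u)\<close>, and the difference is \<open>(x - y) P u\<close>. Here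
  \<open>P u\<close> may be replaced by \<open>P (1 - y u) u\<close>, since \<open>u\<close> squares
  to zero.\<close>

lemma fk_divided_difference:
  assumes "1 \<le> i" "i < q" "Suc i \<le> k"
  shows "fk q k w - subst (Var \<circ> Transposition.transpose i (i + 1)) (fk q k w) =
    (Var i - Var (i + 1)) * nil i (fk q k) w"
  using assms(3)
proof (induction k arbitrary: w rule: dec_induct)
  case base
  obtain j where i: "i = Suc j" using assms(1) by (cases i) auto
  define l where "l = q - Suc i"
  have l: "q - i = Suc l" using assms(2) by (simp add: l_def)
  let ?x = "Var i" and ?y = "Var (Suc i)" and ?G = "fk q j"
  define P where "P = row i (Suc l) ?y (row i (Suc l) ?x ?G)"
  have fk1: "fk q (Suc i) = row (Suc i) l ?y (row i (Suc l) ?x ?G)"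
    using l by (simp add: i l_def)
  also have "\<dots> = fac i (- ?y) P"
    by (simp add: P_def fac_fac fac_zero)
  finally have fkP: "fk q (Suc i) = fac i (- ?y) P" .
  have G: "(\<lambda>w. subst (Var \<circ> Transposition.transpose i (i + 1)) (?G w)) = ?G"
    using fk_swap_invariant[of j i q] by (simp add: i)
  have P: "(\<lambda>w. subst (Var \<circ> Transposition.transpose i (i + 1)) (P w)) = P"
    unfolding P_def subst_row G by (simp add: row_commute del: row.simps)
  have *: "subst (Var \<circ> Transposition.transpose i (i + 1)) (fk q (Suc i) w) = P w - ?x * nil i P w"
    using P unfolding fkP fac_def subst_simps subst_nil by (simp add: fun_eq_iff)
  show ?case
    unfolding * unfolding fkP fac_def nil_linear nil_nil by (simp add: algebra_simps)
next
  case (step k)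
  define G where "G = fk q k"
  define \<sigma> where "\<sigma> = Var \<circ> Transposition.transpose i (i + 1)"
  have IH: "(\<lambda>w. G w - subst \<sigma> (G w)) = (\<lambda>w. (Var i - Var (i+1)) * nil i G w)"
    unfolding G_def \<sigma>_def by (rule ext) (rule step.IH)
  have \<sigma>: "\<sigma> (Suc k) = Var (Suc k)"
    using step.hyps by (simp add: \<sigma>_def Transposition.transpose_def)
  \<comment> \<open>The later rows contain neither variable, and their generators lie beyond
    \<open>i + 1\<close>, hence commute with the generator \<open>i\<close>.\<close>
  have "row (Suc k) (q - Suc k) (Var (Suc k)) (\<lambda>w. G w - subst \<sigma> (G w)) w
     = (Var i - Var (i+1)) * nil i (row (Suc k) (q - Suc k) (Var (Suc k)) G) w"
    using step.hyps by (simp add: IH row_cmult nil_row_commute)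
  then show ?case
    by (simp only: fk.simps G_def[symmetric] \<sigma>_def[symmetric] subst_row row_diff subst_Var \<sigma>)
qed

lemma divided_difference_fk:
  assumes "1 \<le> i" "i < q" "w i > w (i + 1)"
  shows "divided_difference i (fk q q w) = fk q q (w \<circ> Transposition.transpose i (i + 1))"
  unfolding divided_difference_def
proof (rule the_equality)
  have "fk q q w - subst (Var \<circ> Transposition.transpose i (i + 1)) (fk q q w) =
    (Var i - Var (i + 1)) * nil i (fk q q) w"
    using assms by (intro fk_divided_difference) auto
  moreover have "nil i (fk q q) w = fk q q (w \<circ> Transposition.transpose i (i + 1))"
    using assms by (simp add: nil_def)
  ultimately show *: "(Var i - Var (i + 1)) * fk q q (w \<circ> Transposition.transpose i (i + 1)) =
      fk q q w - subst (Var \<circ> Transposition.transpose i (i + 1)) (fk q q w)" by simp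
  fix g
  assume "(Var i - Var (i + 1)) * g = fk q q w - subst (Var \<circ> Transposition.transpose i (i + 1)) (fk q q w)"
  then have "(Var i - Var (i + 1)) * g =
      (Var i - Var (i + 1)) * fk q q (w \<circ> Transposition.transpose i (i + 1))"
    using * by simp
  moreover have "Var i - Var (i + 1) \<noteq> 0"
    by (simp add: Var_eq_iff)
  ultimately show "g = fk q q (w \<circ> Transposition.transpose i (i + 1))"
    by simp
qed

text \<open>
  The one-line notation \<open>q, \<dots>, q - k + 2, 1, \<dots>, q - k\<close> with \<open>q - k + 1\<close> inserted at position \<open>j\<close>: among the
  permutations beginning with the first \<open>k - 1\<close> entries of the longest one, only these are reached
  within row \<open>k\<close> of the product.
\<close>

definition stage :: "nat \<Rightarrow> nat \<Rightarrow> nat \<Rightarrow> nat \<Rightarrow> nat" where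
  "stage q k j i = (if i = 0 \<or> i > q then i else if i < k then q + 1 - i else if i < j then i + 1 - k
     else if i = j then q + 1 - k else i - k)"

lemma stage_swap:
  assumes "1 \<le> k" "k \<le> j" "j < q"
  shows "stage q k (Suc j) \<circ> Transposition.transpose j (Suc j) = stage q k j"
  using assms by (auto simp: fun_eq_iff stage_def Transposition.transpose_def)

text \<open>Here \<open>i\<close> is the position of the entry \<open>q + 1 - k\<close> in
  \<open>v\<close>. Generators beyond \<open>j\<close> cannot bring this entry from position
  \<open>q\<close> to a position up to \<open>j\<close>, so no generator of the row may be skipped:
  each carries the entry one place to the left and contributes a factor \<open>x\<close>. The case
  \<open>i < j\<close>, with value 0, is what the induction needs for the skipped terms.\<close>

lemma row_stage:
  assumes "1 \<le> k" "j + l = q" "k \<le> i" "i \<le> j"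
    and f: "\<And>v. (\<forall>i\<in>{1..<k}. v i = q + 1 - i) \<Longrightarrow> f v = (if v = stage q k q then c else 0)"
    and v: "\<forall>i\<in>{1..<k}. v i = q + 1 - i" "v i = q + 1 - k"
  shows "row j l x f v = (if v = stage q k j then x ^ l * c else 0)"
  using assms(2-4) v
proof (induction l arbitrary: i j v)
  case 0
  then show ?case using f by simp
next
  case (Suc l)
  define v' where "v' = v \<circ> Transposition.transpose j (Suc j)"
  have rec: "row j (Suc l) x f v =
      row (Suc j) l x f v + x * (if v (Suc j) < v j then row (Suc j) l x f v' else 0)"
    by (simp add: fac_def nil_def v'_def)
  have ne: "u \<noteq> stage q k (Suc j)" if "u i = q + 1 - k" "i \<le> j" for u
    using that Suc.prems assms(1) by (auto simp: stage_def)
  have 1: "row (Suc j) l x f v = 0"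
    using Suc.IH[of "Suc j" i v] Suc.prems ne[of v] by auto
  have v'_top: "\<forall>i\<in>{1..<k}. v' i = q + 1 - i"
    using Suc.prems by (auto simp: v'_def Transposition.transpose_def)
  show ?case
  proof (cases "i = j")
    case True
    have v'_Suc: "v' (Suc j) = v j" by (simp add: v'_def)
    have 2: "row (Suc j) l x f v' = (if v' = stage q k (Suc j) then x ^ l * c else 0)"
      using Suc.IH[of "Suc j" "Suc j" v'] v'_top Suc.prems True v'_Suc by auto
    have 3: "v' = stage q k (Suc j) \<longleftrightarrow> v = stage q k j"
    proof
      assume "v' = stage q k (Suc j)"
      then have "v' \<circ> Transposition.transpose j (Suc j) = stage q k j"
        using stage_swap[of k j q] assms(1) Suc.prems by simp
      then show "v = stage q k j" by (simp add: v'_def comp_assoc)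
    next
      assume "v = stage q k j"
      then have "v = stage q k (Suc j) \<circ> Transposition.transpose j (Suc j)"
        using stage_swap[of k j q] assms(1) Suc.prems by simp
      then show "v' = stage q k (Suc j)" by (simp add: v'_def comp_assoc)
    qed
    have "v (Suc j) < v j" if "v = stage q k j"
      using that Suc.prems assms(1) by (auto simp: stage_def)
    then show ?thesis
      unfolding rec using 1 2 3 by (auto simp: mult.assoc)
  next
    case False
    then have i: "i < j" using Suc.prems by simp
    then have "v' i = q + 1 - k" using Suc.prems by (simp add: v'_def Transposition.transpose_def)
    then have "row (Suc j) l x f v' = 0"
      using Suc.IH[of "Suc j" i v'] v'_top Suc.prems ne[of v'] i by auto
    moreover have "v \<noteq> stage q k j"
      using Suc.prems assms(1) i by (auto simp: stage_def)
    ultimately show ?thesis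
      unfolding rec using 1 by simp
  qed
qed

lemma fk_stage:
  assumes "k \<le> q" "\<forall>i\<in>{1..<Suc k}. v i = q + 1 - i"
  shows "fk q k v = (if v = stage q (Suc k) q then \<Prod>i\<in>{1..k}. Var i ^ (q - i) else 0)"
  using assms
proof (induction k arbitrary: v)
  case 0
  have "stage q (Suc 0) q = id" by (auto simp: stage_def fun_eq_iff)
  then show ?case by (simp add: delta_def del: id_apply)
next
  case (Suc k)
  have "row (Suc k) (q - Suc k) (Var (Suc k)) (fk q k) v =
      (if v = stage q (Suc k) (Suc k) then Var (Suc k) ^ (q - Suc k) * (\<Prod>i\<in>{1..k}. Var i ^ (q - i)) else 0)"
    using Suc.prems by (intro row_stage[where i = "Suc k"] Suc.IH) auto
  \<comment> \<open>The end of one row is the starting point of the next.\<close>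
  moreover have "stage q (Suc k) (Suc k) = stage q (Suc (Suc k)) q"
    using Suc.prems by (auto simp: stage_def fun_eq_iff)
  ultimately show ?case by (simp add: mult.commute)
qed

lemma fk_longest: "fk q q (longest_perm q) = (\<Prod>i\<in>{1..<q}. Var i ^ (q - i))"
proof -
  have "longest_perm q = stage q (Suc q) q"
    by (auto simp: longest_perm_def stage_def fun_eq_iff)
  moreover have "\<forall>i\<in>{1..<Suc q}. longest_perm q i = q + 1 - i"
    by (auto simp: longest_perm_def)
  ultimately have "fk q q (longest_perm q) = (\<Prod>i\<in>{1..q}. Var i ^ (q - i))"
    using fk_stage[of q q "longest_perm q"] by simp
  also have "\<dots> = (\<Prod>i\<in>{1..<q}. Var i ^ (q - i))"
    by (rule prod.mono_neutral_right) (auto simp: Suc_le_eq)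
  finally show ?thesis .
qed

text \<open>Every chain of descents leads to the same coefficient, which gives uniqueness for the
  \<open>THE\<close> in \<open>schubert\<close>.\<close>

lemma is_schubert_fk: "is_schubert q w f \<Longrightarrow> f = fk q q w"
  by (induction rule: is_schubert.induct) (simp_all only: fk_longest divided_difference_fk)

section \<open>Existence of chains of descents\<close>

lemma decreasing_permutation_eq_longest:
  assumes v: "v permutes {1..q}" and dec: "\<And>i. 1 \<le> i \<Longrightarrow> i < q \<Longrightarrow> v (Suc i) < v i"
  shows "v = longest_perm q"
proof
  fix i
  have in_range: "v j \<in> {1..q} \<longleftrightarrow> j \<in> {1..q}" for j
    using permutes_in_image[OF v] .
  \<comment> \<open>The sum \<open>v i + i\<close> never increases with \<open>i\<close>; it is at
    most \<open>q + 1\<close> at the first position and at least \<open>q + 1\<close> at the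
    last.\<close>
  have le: "v i + i \<le> q + 1" if "1 \<le> i" "i \<le> q"
    using that
  proof (induction i rule: dec_induct)
    case base
    then show ?case using in_range[of 1] by simp
  next
    case (step i)
    then show ?case using dec[of i] by simp
  qed
  have ge: "q + 1 \<le> v i + i" if "i \<le> q" "1 \<le> i"
    using that
  proof (induction i rule: inc_induct)
    case base
    then show ?case using in_range[of q] by simp
  next
    case (step i)
    then show ?case using dec[of i] by simp
  qed
  show "v i = longest_perm q i"
  proof (cases "i \<in> {1..q}")
    case True
    then show ?thesis using le ge by (simp add: longest_perm_def)
  next
    case False
    then show ?thesis using permutes_not_in[OF v False] by (simp only: longest_perm_def if_False)
  qed
qed

lemma permutes_comp_adjacent:
  fixes v :: "nat \<Rightarrow> nat"
  assumes "v permutes {1..q}" "1 \<le> i" "i < q"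
  shows "v \<circ> Transposition.transpose i (i + 1) permutes {1..q}"
  by (rule permutes_compose[OF permutes_swap_id assms(1)]) (use assms(2,3) in simp_all)

text \<open>Exchanging an ascent lowers the sum of the \<open>i * v i\<close>, and only the longest
  permutation has no ascent. Undoing the exchange is a step along a descent.\<close>

lemma is_schubert_exists:
  assumes "v permutes {1..q}"
  shows "\<exists>f. is_schubert q v f"
  using assms
proof (induction "\<Sum>i\<in>{1..q}. i * v i" arbitrary: v rule: less_induct)
  case less
  show ?case
  proof (cases "\<exists>i. 1 \<le> i \<and> i < q \<and> v i \<le> v (Suc i)")
    case False
    then have "v = longest_perm q"
      using less.prems by (intro decreasing_permutation_eq_longest) (auto simp: not_le)
    then show ?thesis using is_schubert.longest by blast
  next
    case True
    then obtain i where i: "1 \<le> i" "i < q" "v i \<le> v (Suc i)" by blast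
    moreover have "v i \<noteq> v (Suc i)"
      using permutes_inj[OF less.prems] by (metis inj_eq n_not_Suc_n)
    ultimately have asc: "v i < v (Suc i)" by simp
    define u where "u = v \<circ> Transposition.transpose i (i + 1)"
    have u: "u permutes {1..q}"
      using permutes_comp_adjacent less.prems i unfolding u_def by blast
    have "{1..q} = insert i (insert (Suc i) ({1..q} - {i, Suc i}))"
      using i by auto
    then have split: "(\<Sum>j\<in>{1..q}. g j) = g i + g (Suc i) + (\<Sum>j\<in>{1..q} - {i, Suc i}. g j)"
      for g :: "nat \<Rightarrow> nat"
      by (metis (no_types, lifting) Diff_iff Groups.add_ac(1) finite_Diff finite_atLeastAtMost finite_insert
          insert_iff n_not_Suc_n sum.insert)
    have "(\<Sum>j\<in>{1..q} - {i, Suc i}. j * u j) = (\<Sum>j\<in>{1..q} - {i, Suc i}. j * v j)"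
      by (rule sum.cong) (auto simp: u_def)
    moreover have "i * u i + Suc i * u (Suc i) < i * v i + Suc i * v (Suc i)"
      using asc by (simp add: u_def)
    ultimately have "(\<Sum>j\<in>{1..q}. j * u j) < (\<Sum>j\<in>{1..q}. j * v j)"
      using split[of "\<lambda>j. j * u j"] split[of "\<lambda>j. j * v j"] by linarith
    then obtain f where "is_schubert q u f" using less.hyps u by blast
    moreover have "u i > u (i + 1)" using asc by (simp add: u_def)
    ultimately have "is_schubert q (u \<circ> Transposition.transpose i (i + 1)) (divided_difference i f)"
      using i by (intro is_schubert.descent) auto
    then show ?thesis by (auto simp: u_def comp_assoc)
  qed
qed

lemma schubert_eq_fk:
  assumes "v permutes {1..q}"
  shows "schubert q v = fk q q v"
  unfolding schubert_def
  using is_schubert_exists[OF assms] is_schubert_fk by (metis the_equality)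

section \<open>Stable specialization\<close>

text \<open>A Stanley symmetric polynomial in \<open>k\<close> variables: unlike in
  \<open>fk\<close>, all rows use the same generators \<open>1, ..., p - 1\<close>.\<close>

fun stanley :: "nat \<Rightarrow> nat \<Rightarrow> (nat \<Rightarrow> nat) \<Rightarrow> ipoly" where
  "stanley p 0 = delta"
| "stanley p (Suc k) = row 1 (p - 1) (Var (Suc k)) (stanley p k)"

lemma row_zero: "row i l 0 f = f"
  by (induction l arbitrary: i) (simp_all add: fac_zero)

definition pad :: "nat \<Rightarrow> (nat \<Rightarrow> nat) \<Rightarrow> nat \<Rightarrow> nat" where
  "pad m v = perm_times m id v"

lemmas pad_eq = pad_def perm_times_def

lemma pad_comp_adjacent:
  assumes "1 \<le> j"
  shows "pad m v \<circ> Transposition.transpose (m + j) (m + j + 1) =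
    pad m (v \<circ> Transposition.transpose j (j + 1))"
  using assms by (auto simp: fun_eq_iff pad_eq Transposition.transpose_def)

lemma row_shift:
  assumes "\<And>v. v permutes {1..p} \<Longrightarrow> f (pad m v) = g v"
    and "1 \<le> j" "j + l \<le> p" "v permutes {1..p}"
  shows "row (m + j) l x f (pad m v) = row j l x g v"
  using assms(2-4)
proof (induction l arbitrary: j v)
  case 0
  then show ?case by (simp only: row.simps assms(1))
next
  case (Suc l)
  have *: "row (Suc (m + j)) l x f (pad m v) = row (Suc j) l x g v"
    if "v permutes {1..p}" for v
    using Suc.IH[of "Suc j" v] Suc.prems that by simp
  have "v \<circ> Transposition.transpose j (j + 1) permutes {1..p}"
    using Suc.prems by (intro permutes_comp_adjacent) auto
  from *[OF this] show ?case
    using *[OF Suc.prems(3)] pad_comp_adjacent[of j m v] Suc.prems(1)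
    by (simp add: fac_def nil_def) (simp add: pad_eq)
qed

text \<open>The factors of smallest index are outermost, hence act directly at
  \<open>pad m v\<close>, which has no descent at a position up to \<open>m\<close>. They drop out,
  and the generators beyond \<open>m\<close> act on the shifted copy of \<open>v\<close>.\<close>

lemma row_stable:
  assumes "\<And>v. v permutes {1..p} \<Longrightarrow> f (pad m v) = g v"
    and "i \<le> Suc m" "1 \<le> i" "1 \<le> p" "v permutes {1..p}"
  shows "row i (m + p - i) x f (pad m v) = row 1 (p - 1) x g v"
  using assms(2,3)
proof (induction i rule: inc_induct)
  case base
  then show ?case using row_shift[of p f m g 1 "p - 1" v x] assms by simp
next
  case (step i)
  have l: "m + p - i = Suc (m + p - Suc i)" using step.hyps assms(4) by simp
  \<comment> \<open>This settles the position \<open>i = m\<close>, where the next entry is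
    \<open>v 1 + m\<close>.\<close>
  have "v (Suc m - m) \<ge> 1"
    using permutes_in_image[OF assms(5), of 1] assms(4) by simp
  then have "\<not> pad m v (Suc i) < pad m v i"
    using step.hyps by (auto simp: pad_eq)
  then show ?case
    using step.IH by (simp add: l fac_def nil_def)
qed

text \<open>For the first \<open>n\<close> rows \<open>row_stable\<close> applies, as they start at
  a generator not beyond \<open>m\<close>. In all further rows the variable becomes 0, so they act
  as the identity.\<close>

lemma subst_schubert_stable:
  assumes v: "v permutes {1..p}" and "1 \<le> p" "n \<le> m"
  shows "subst (\<lambda>i. if 1 \<le> i \<and> i \<le> n then Var i else 0) (schubert (m + p) (perm_times m id v)) =
    stanley p n v"
proof -
  define \<sigma> where "\<sigma> = (\<lambda>i. if 1 \<le> i \<and> i \<le> n then Var i else 0)"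
  have "subst \<sigma> (fk (m + p) k (pad m v)) = stanley p k v"
    if "k \<le> n" "v permutes {1..p}" for k v
    using that
  proof (induction k arbitrary: v)
    case 0
    have "pad m v = id \<longleftrightarrow> v = id"
    proof
      assume *: "pad m v = id"
      show "v = id"
      proof
        fix i
        show "v i = id i"
          using fun_cong[OF *, of "i + m"] permutes_not_in[OF 0(2), of 0]
          by (cases "i = 0") (auto simp: pad_eq)
      qed
    qed (auto simp: pad_eq fun_eq_iff)
    then show ?case by (simp only: fk.simps stanley.simps subst_delta) (simp only: delta_def)
  next
    case (Suc k)
    have "\<sigma> (Suc k) = Var (Suc k)" using Suc.prems by (simp add: \<sigma>_def)
    then show ?case
      using row_stable[of p "\<lambda>w. subst \<sigma> (fk (m + p) k w)" m "stanley p k" "Suc k" v "Var (Suc k)"]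
        Suc assms by (simp add: subst_row)
  qed
  moreover have "subst \<sigma> (fk (m + p) k w) = subst \<sigma> (fk (m + p) n w)" if "n \<le> k" for k w
    using that
  proof (induction k arbitrary: w rule: dec_induct)
    case (step k)
    then have "\<sigma> (Suc k) = 0" by (simp add: \<sigma>_def)
    then show ?case using step.IH by (simp add: subst_row row_zero)
  qed simp
  moreover have "pad m v permutes {1..m + p}"
  proof -
    have pv: "v i \<in> {1..p} \<longleftrightarrow> i \<in> {1..p}" for i using permutes_in_image[OF v] .
    show ?thesis
    proof (rule bij_imp_permutes)
      have "inj_on (pad m v) {1..m + p}"
      proof (rule inj_onI)
        fix x y assume "x \<in> {1..m+p}" "y \<in> {1..m+p}" "pad m v x = pad m v y"
        then show "x = y"
          using pv[of "x - m"] pv[of "y - m"] injD[OF permutes_inj[OF v], of "x - m" "y - m"]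
          by (auto simp: pad_eq split: if_splits)
      qed
      moreover have "pad m v ` {1..m + p} \<subseteq> {1..m + p}"
      proof safe
        fix x assume "x \<in> {1..m+p}"
        then show "pad m v x \<in> {1..m + p}"
          using pv[of "x - m"] by (auto simp: pad_eq)
      qed
      ultimately show "bij_betw (pad m v) {1..m + p} {1..m + p}"
        by (simp add: bij_betw_def endo_inj_surj)
      show "pad m v x = x" if "x \<notin> {1..m + p}" for x
        proof (cases "x \<le> m")
        case False
        then have "x - m \<notin> {1..p}" using that by auto
        then show ?thesis using False permutes_not_in[OF v] by (simp add: pad_eq)
      qed (simp add: pad_eq)
    qed
  qed
  ultimately show ?thesis
    unfolding pad_def[symmetric] \<sigma>_def[symmetric] using assms
    by (metis schubert_eq_fk order_refl trans_le_add1)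
qed

section \<open>The permutation of a skew shape\<close>

text \<open>A common box for both partitions gives their boundary paths the same length
  \<open>r + c\<close>, so that both paths permute the same labels.\<close>

definition in_box :: "nat \<Rightarrow> nat \<Rightarrow> (nat \<Rightarrow> nat) \<Rightarrow> bool" where
  "in_box r c lam \<longleftrightarrow> antimono_on {1..} lam \<and> (\<forall>i\<ge>1. lam i \<le> c) \<and> (\<forall>i>r. lam i = 0)"

definition col :: "nat \<Rightarrow> (nat \<Rightarrow> nat) \<Rightarrow> nat \<Rightarrow> nat" where
  "col r lam k = card {i\<in>{1..r}. k \<le> lam i}"

text \<open>
  The boundary path of the diagram, from its north-east to its south-west end, has a vertical step
  in each row and a horizontal step in each column. \<open>path\<close> sends row \<open>i\<close>, encoded as \<open>i\<close>, and column
  \<open>k\<close>, encoded as \<open>r + k\<close>, to the position of its step.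
\<close>

definition path :: "nat \<Rightarrow> nat \<Rightarrow> (nat \<Rightarrow> nat) \<Rightarrow> nat \<Rightarrow> nat" where
  "path r c lam p = (if 1 \<le> p \<and> p \<le> r then p + c - lam p
     else if r < p \<and> p \<le> r + c then col r lam (p - r) + c + 1 - (p - r) else p)"

definition skew_perm :: "nat \<Rightarrow> nat \<Rightarrow> (nat \<Rightarrow> nat) \<Rightarrow> (nat \<Rightarrow> nat) \<Rightarrow> nat \<Rightarrow> nat" where
  "skew_perm r c lam mu = path r c mu \<circ> inv (path r c lam)"

definition corner :: "(nat \<Rightarrow> nat) \<Rightarrow> nat \<Rightarrow> nat \<Rightarrow> bool" where
  "corner lam i k \<longleftrightarrow> 1 \<le> i \<and> 1 \<le> k \<and> lam i = k \<and> lam (Suc i) < k"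

section \<open>Order of the steps on a boundary path\<close>

lemma in_box_antimono: "in_box r c lam \<Longrightarrow> 1 \<le> i \<Longrightarrow> i \<le> j \<Longrightarrow> lam j \<le> lam i"
  unfolding in_box_def by (auto elim: monotone_onD)

lemma in_box_le: "in_box r c lam \<Longrightarrow> 1 \<le> i \<Longrightarrow> lam i \<le> c"
  by (auto simp: in_box_def)

lemma in_box_zero: "in_box r c lam \<Longrightarrow> r < i \<Longrightarrow> lam i = 0"
  by (auto simp: in_box_def)

text \<open>The rows reaching column \<open>k\<close> form an initial segment, so
  \<open>col r lam\<close> is the conjugate partition.\<close>

lemma le_col_iff:
  assumes lam: "in_box r c lam" and "1 \<le> i" "i \<le> r"
  shows "i \<le> col r lam k \<longleftrightarrow> k \<le> lam i"
proof
  assume "k \<le> lam i"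
  then have "{1..i} \<subseteq> {i\<in>{1..r}. k \<le> lam i}"
    using in_box_antimono[OF lam] assms by (auto intro: order_trans)
  from card_mono[OF _ this] show "i \<le> col r lam k" by (simp add: col_def)
next
  assume *: "i \<le> col r lam k"
  show "k \<le> lam i"
  proof (rule ccontr)
    assume neg: "\<not> k \<le> lam i"
    have "{i\<in>{1..r}. k \<le> lam i} \<subseteq> {1..<i}"
    proof
      fix x assume x: "x \<in> {i\<in>{1..r}. k \<le> lam i}"
      then have "\<not> i \<le> x" using in_box_antimono[OF lam assms(2), of x] neg by auto
      then show "x \<in> {1..<i}" using x by auto
    qed
    from card_mono[OF _ this] show False using * assms by (simp add: col_def)
  qed
qed

lemma col_le: "col r lam k \<le> r"
proof -
  have "card {i\<in>{1..r}. k \<le> lam i} \<le> card {1..r}" by (rule card_mono) auto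
  then show ?thesis by (simp add: col_def)
qed

lemma col_antimono: "k \<le> k' \<Longrightarrow> col r lam k' \<le> col r lam k"
  unfolding col_def by (rule card_mono) auto

lemma path_row: "1 \<le> i \<Longrightarrow> i \<le> r \<Longrightarrow> path r c lam i = i + c - lam i"
  by (simp add: path_def)

lemma path_col: "1 \<le> k \<Longrightarrow> k \<le> c \<Longrightarrow> path r c lam (r + k) = col r lam k + c + 1 - k"
  by (simp add: path_def)

lemma path_row_mono:
  assumes "in_box r c lam" "1 \<le> a" "a < b" "b \<le> r"
  shows "path r c lam a < path r c lam b"
  using in_box_antimono[OF assms(1), of a b] in_box_le[OF assms(1), of a] assms by (simp add: path_row)

lemma path_col_antimono:
  assumes "in_box r c lam" "r < a" "a < b" "b \<le> r + c"
  shows "path r c lam b < path r c lam a"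
proof -
  have "col r lam (b - r) \<le> col r lam (a - r)" using assms by (intro col_antimono) simp
  then show ?thesis using assms by (simp add: path_def)
qed

text \<open>The path, coming from the north-east, passes row \<open>i\<close> before column
  \<open>k\<close> exactly when the box \<open>(i, k)\<close> is in the diagram; the next lemma is
  the other case.\<close>

lemma path_row_less_col:
  assumes "in_box r c lam" "1 \<le> i" "i \<le> r" "1 \<le> k" "k \<le> c" "k \<le> lam i"
  shows "path r c lam i < path r c lam (r + k)"
  using assms le_col_iff[OF assms(1-3), of k] in_box_le[OF assms(1,2)] by (simp add: path_row path_col)

lemma path_col_less_row:
  assumes "in_box r c lam" "1 \<le> i" "i \<le> r" "1 \<le> k" "k \<le> c" "\<not> k \<le> lam i"
  shows "path r c lam (r + k) < path r c lam i"
  using assms le_col_iff[OF assms(1-3), of k] in_box_le[OF assms(1,2)] by (simp add: path_row path_col)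

lemma label_cases:
  assumes "a \<in> {1..r + c}"
  obtains "1 \<le> a" "a \<le> r" | k where "a = r + k" "1 \<le> k" "k \<le> (c :: nat)"
proof (cases "a \<le> r")
  case True
  then show ?thesis using assms that(1) by simp
next
  case False
  then show ?thesis using assms that(2)[of "a - r"] by simp
qed

lemma path_permutes:
  assumes lam: "in_box r c lam"
  shows "path r c lam permutes {1..r + c}"
proof (rule bij_imp_permutes)
  have "path r c lam a \<noteq> path r c lam b" if "a \<in> {1..r + c}" "b \<in> {1..r + c}" "a < b" for a b
  proof (cases rule: label_cases[OF that(1)])
    case 1
    show ?thesis
    proof (cases rule: label_cases[OF that(2)])
      case 1
      then show ?thesis using path_row_mono[OF lam _ that(3)] that by simp
    next
      case (2 k)
      then show ?thesis
        using path_row_less_col[OF lam 1, of k] path_col_less_row[OF lam 1, of k] by fastforce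
    qed
  next
    case (2 k)
    then show ?thesis using path_col_antimono[OF lam _ that(3)] that by auto
  qed
  then have "inj_on (path r c lam) {1..r + c}"
    by (intro linorder_inj_onI) auto
  moreover have "path r c lam ` {1..r + c} \<subseteq> {1..r + c}"
  proof safe
    fix a assume "a \<in> {1..r + c}"
    then show "path r c lam a \<in> {1..r + c}"
    proof (cases rule: label_cases)
      case 1
      then show ?thesis
        using in_box_le[OF lam 1(1)] unfolding path_row[OF 1] atLeastAtMost_iff by linarith
    next
      case (2 k)
      then show ?thesis using col_le[of r lam k] 2 unfolding 2(1) path_col[OF 2(2,3)] atLeastAtMost_iff by linarith
    qed
  qed
  ultimately show "bij_betw (path r c lam) {1..r + c} {1..r + c}"
    by (simp add: bij_betw_def endo_inj_surj)
qed (auto simp: path_def)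

lemma skew_perm_permutes:
  assumes "in_box r c lam" "in_box r c mu"
  shows "skew_perm r c lam mu permutes {1..r + c}"
  unfolding skew_perm_def
  by (rule permutes_compose[OF permutes_inv[OF path_permutes[OF assms(1)]] path_permutes[OF assms(2)]])

lemma skew_perm_path:
  assumes "in_box r c lam"
  shows "skew_perm r c lam mu (path r c lam a) = path r c mu a"
  using permutes_inverses(2)[OF path_permutes[OF assms]] by (simp add: skew_perm_def)

lemma obtain_label:
  assumes "in_box r c lam" "j \<in> {1..r + c}"
  obtains a where "a \<in> {1..r + c}" "path r c lam a = j"
  using permutes_image[OF path_permutes[OF assms(1)]] assms(2) by (metis imageE)

text \<open>Every boundary path meets the rows from top to bottom and the columns from right to
  left, so two paths order labels of the same kind alike.\<close>

lemma skew_perm_mono: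
  assumes lam: "in_box r c lam" and mu: "in_box r c mu"
    and ab: "a \<in> {1..r + c}" "b \<in> {1..r + c}" "path r c lam a < path r c lam b" "a \<le> r \<longleftrightarrow> b \<le> r"
  shows "path r c mu a < path r c mu b"
proof (cases "a \<le> r")
  case True
  have "\<not> b < a" "a \<noteq> b"
    using path_row_mono[OF lam, of b a] ab True by auto
  then show ?thesis using path_row_mono[OF mu, of a b] ab True by auto
next
  case False
  have "\<not> a < b" "a \<noteq> b"
    using path_col_antimono[OF lam, of a b] ab False by auto
  then show ?thesis using path_col_antimono[OF mu, of b a] ab False by auto
qed

text \<open>Of three positions, two are both rows or both columns.\<close>

lemma skew_perm_avoids_321:
  assumes lam: "in_box r c lam" and mu: "in_box r c mu"
  shows "avoids_321 (r + c) (skew_perm r c lam mu)"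
  unfolding avoids_321_def
proof
  assume "\<exists>i j k. 1 \<le> i \<and> i < j \<and> j < k \<and> k \<le> r + c \<and> skew_perm r c lam mu j < skew_perm r c lam mu i \<and>
    skew_perm r c lam mu k < skew_perm r c lam mu j"
  then obtain i j k where *: "1 \<le> i" "i < j" "j < k" "k \<le> r + c"
      "skew_perm r c lam mu j < skew_perm r c lam mu i" "skew_perm r c lam mu k < skew_perm r c lam mu j"
    by blast
  obtain x where x: "x \<in> {1..r + c}" "path r c lam x = i"
    by (rule obtain_label[OF lam, of i]) (use * in auto)
  obtain y where y: "y \<in> {1..r + c}" "path r c lam y = j"
    by (rule obtain_label[OF lam, of j]) (use * in auto)
  obtain z where z: "z \<in> {1..r + c}" "path r c lam z = k"
    by (rule obtain_label[OF lam, of k]) (use * in auto)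
  have "path r c mu y < path r c mu x" "path r c mu z < path r c mu y"
    using * skew_perm_path[OF lam, of mu] x y z by auto
  then show False
    using skew_perm_mono[OF lam mu, of x y] skew_perm_mono[OF lam mu, of y z] skew_perm_mono[OF lam mu, of x z]
      x y z * by linarith
qed

lemma skew_perm_eq_id_iff:
  assumes lam: "in_box r c lam" and mu: "in_box r c mu"
  shows "skew_perm r c lam mu = id \<longleftrightarrow> (\<forall>i\<ge>1. lam i = mu i)"
proof
  assume id: "skew_perm r c lam mu = id"
  show "\<forall>i\<ge>1. lam i = mu i"
  proof (intro allI impI)
    fix i :: nat assume i: "1 \<le> i"
    have "path r c mu i = path r c lam i"
      using skew_perm_path[OF lam, of mu i] id by simp
    then show "lam i = mu i"
      using in_box_le[OF lam i] in_box_le[OF mu i] in_box_zero[OF lam, of i] in_box_zero[OF mu, of i] i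
      by (cases "i \<le> r") (simp_all add: path_row)
  qed
next
  assume *: "\<forall>i\<ge>1. lam i = mu i"
  then have "{i\<in>{1..r}. k \<le> lam i} = {i\<in>{1..r}. k \<le> mu i}" for k
    by auto
  with * have "path r c mu = path r c lam"
    by (simp add: fun_eq_iff path_def col_def)
  then show "skew_perm r c lam mu = id"
    using permutes_inv_o(1)[OF path_permutes[OF lam]] by (simp add: skew_perm_def)
qed

section \<open>Corners and descents\<close>

lemma corner_bounds:
  assumes "in_box r c lam" "corner lam i k"
  shows "1 \<le> i" "i \<le> r" "1 \<le> k" "k \<le> c" "lam i = k" "col r lam k = i"
proof -
  show i: "1 \<le> i" and "1 \<le> k" and "lam i = k" using assms(2) by (auto simp: corner_def)
  show ir: "i \<le> r" using in_box_zero[OF assms(1), of i] assms(2) by (auto simp: corner_def not_le[symmetric])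
  show "k \<le> c" using in_box_le[OF assms(1) i] \<open>lam i = k\<close> by simp
  have "i \<le> col r lam k" using le_col_iff[OF assms(1) i ir, of k] \<open>lam i = k\<close> by simp
  moreover have "\<not> Suc i \<le> col r lam k"
    using le_col_iff[OF assms(1), of "Suc i" k] col_le[of r lam k] assms(2)
    by (auto simp: corner_def dest: order_trans)
  ultimately show "col r lam k = i" by simp
qed

text \<open>At a corner a vertical step is directly followed by a horizontal one; removing the box
  interchanges these two steps.\<close>

lemma corner_path:
  assumes "in_box r c lam" "corner lam i k"
  shows "path r c lam i = i + c - k" "path r c lam (r + k) = Suc (i + c - k)"
  using corner_bounds[OF assms] by (simp_all add: path_row path_col Suc_diff_le)

lemma in_box_remove_corner:
  assumes "in_box r c lam" "corner lam i k"
  shows "in_box r c (lam(i := k - 1))"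
proof -
  have "(lam(i := k - 1)) y \<le> (lam(i := k - 1)) x" if "1 \<le> x" "x \<le> y" for x y
    using in_box_antimono[OF assms(1), of x y] in_box_antimono[OF assms(1), of "Suc i" y] that assms(2)
    by (auto simp: corner_def)
  then have "antimono_on {1..} (lam(i := k - 1))"
    by (auto intro!: monotone_onI)
  then show ?thesis
    using in_box_le[OF assms(1)] in_box_zero[OF assms(1)] corner_bounds[OF assms]
    by (auto simp: in_box_def intro: order_trans[of _ k])
qed

lemma path_remove_corner:
  assumes lam: "in_box r c lam" and cor: "corner lam i k"
  shows "path r c (lam(i := k - 1)) =
    Transposition.transpose (i + c - k) (i + c - k + 1) \<circ> path r c lam"
proof
  fix p
  note b = corner_bounds[OF lam cor]
  let ?lam = "lam(i := k - 1)"
  have cor_col: "col r ?lam k = i - 1"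
  proof -
    have "{x\<in>{1..r}. k \<le> ?lam x} = {x\<in>{1..r}. k \<le> lam x} - {i}" using b by auto
    then show ?thesis using b by (simp add: col_def card_Diff_singleton)
  qed
  have other_col: "col r ?lam k' = col r lam k'" if "k' \<noteq> k" for k'
    using that b unfolding col_def by (intro arg_cong[where f = card]) (auto split: if_splits)
  have inj: "path r c lam p = path r c lam q \<longleftrightarrow> p = q" for q
    using permutes_inj[OF path_permutes[OF lam]] by (rule inj_eq)
  consider "p = i" | "p = r + k" | "p \<noteq> i" "p \<noteq> r + k" by blast
  then show "path r c ?lam p = (Transposition.transpose (i + c - k) (i + c - k + 1) \<circ> path r c lam) p"
  proof cases
    case 1
    then show ?thesis using b corner_path[OF lam cor] by (simp add: path_row)
  next
    case 2
    then have "path r c ?lam p = i + c - k"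
      using b cor_col by (simp only: path_col)
    moreover have "path r c lam p = Suc (i + c - k)"
      using 2 corner_path(2)[OF lam cor] by simp
    ultimately show ?thesis by simp
  next
    case 3
    then have "path r c lam p \<noteq> i + c - k" "path r c lam p \<noteq> Suc (i + c - k)"
      using inj[of i] inj[of "r + k"] corner_path[OF lam cor] by auto
    moreover have "path r c ?lam p = path r c lam p"
      using 3 other_col[of "p - r"] by (auto simp: path_def)
    ultimately show ?thesis by simp
  qed
qed

text \<open>Through the inverse in \<open>skew_perm\<close>, the transposition on the left of the
  path becomes one on the right.\<close>

lemma skew_perm_remove_corner:
  assumes lam: "in_box r c lam" and cor: "corner lam i k"
  shows "skew_perm r c (lam(i := k - 1)) mu =
    skew_perm r c lam mu \<circ> Transposition.transpose (i + c - k) (i + c - k + 1)"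
proof -
  have "inv (Transposition.transpose (i + c - k) (i + c - k + 1) \<circ> path r c lam) =
      inv (path r c lam) \<circ> Transposition.transpose (i + c - k) (i + c - k + 1)"
    by (subst o_inv_distrib) (use permutes_bij[OF path_permutes[OF lam]] in auto)
  then show ?thesis
    unfolding skew_perm_def path_remove_corner[OF lam cor] by (simp only: comp_assoc)
qed

lemma skew_perm_descent:
  assumes lam: "in_box r c lam" and mu: "in_box r c mu" and cor: "corner lam i k" and "mu i < k"
  shows "skew_perm r c lam mu (i + c - k) > skew_perm r c lam mu (i + c - k + 1)"
  using skew_perm_path[OF lam, of mu i] skew_perm_path[OF lam, of mu "r + k"] corner_path[OF lam cor]
    path_col_less_row[OF mu, of i k] corner_bounds[OF lam cor] assms(4) by simp

text \<open>By \<open>skew_perm_mono\<close> the labels at a descent are a row and a column. If the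
  column came first on the path of \<open>lam\<close>, their common box would lie in
  \<open>mu\<close> but not in \<open>lam\<close>. So the row comes first, and a vertical step
  directly followed by a horizontal one is a corner.\<close>

lemma skew_perm_descentD:
  assumes lam: "in_box r c lam" and mu: "in_box r c mu" and le: "\<And>i. 1 \<le> i \<Longrightarrow> mu i \<le> lam i"
    and j: "1 \<le> j" "j < r + c" and desc: "skew_perm r c lam mu j > skew_perm r c lam mu (j + 1)"
  shows "\<exists>i k. corner lam i k \<and> mu i < k \<and> j = i + c - k"
proof -
  obtain a where a: "a \<in> {1..r + c}" "path r c lam a = j"
    by (rule obtain_label[OF lam, of j]) (use j in auto)
  obtain b where b: "b \<in> {1..r + c}" "path r c lam b = j + 1"
    by (rule obtain_label[OF lam, of "j + 1"]) (use j in auto)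
  have lt: "path r c mu b < path r c mu a"
    using desc skew_perm_path[OF lam, of mu a] skew_perm_path[OF lam, of mu b] a b by simp
  have "a \<le> r \<longleftrightarrow> \<not> b \<le> r"
    using skew_perm_mono[OF lam mu a(1) b(1)] a b lt by auto
  then consider "a \<le> r" "\<not> b \<le> r" | "\<not> a \<le> r" "b \<le> r" by blast
  then show ?thesis
  proof cases
    case 1
    obtain k where k: "b = r + k" "1 \<le> k" "k \<le> c"
      using label_cases[OF b(1)] 1 by metis
    have i: "1 \<le> a" "a \<le> r" using a 1 by auto
    have "k \<le> lam a"
      using path_col_less_row[OF lam i k(2,3)] a b k by fastforce
    moreover from this have "a \<le> col r lam k" using le_col_iff[OF lam i] by simp
    moreover have "a + c - lam a + 1 = col r lam k + c + 1 - k"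
      using a b k i by (simp add: path_row path_col)
    \<comment> \<open>Adjacency of the positions forces equality in \<open>k \<le> lam a\<close> and
      \<open>a \<le> col r lam k\<close>.\<close>
    ultimately have eq: "lam a = k" "col r lam k = a"
      using in_box_le[OF lam i(1)] by linarith+
    have "\<not> k \<le> lam (Suc a)"
      using le_col_iff[OF lam, of "Suc a" k] in_box_zero[OF lam, of "Suc a"] eq k by (cases "Suc a \<le> r") auto
    then have "corner lam a k" using i k eq by (simp add: corner_def)
    moreover have "mu a < k"
      using path_row_less_col[OF mu i k(2,3)] lt k by (meson not_le order.asym)
    moreover have "j = a + c - k" using a i eq by (simp add: path_row)
    ultimately show ?thesis by blast
  next
    case 2
    obtain k where k: "a = r + k" "1 \<le> k" "k \<le> c"
      using label_cases[OF a(1)] 2 by metis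
    have i: "1 \<le> b" "b \<le> r" using b 2 by auto
    have "k \<le> mu b"
      using path_col_less_row[OF mu i k(2,3)] lt k by fastforce
    then have "k \<le> lam b" using le[OF i(1)] by simp
    then have "path r c lam b < path r c lam a"
      using path_row_less_col[OF lam i k(2,3)] k by simp
    then show ?thesis using a b by simp
  qed
qed

section \<open>Removing the largest entry of a tableau\<close>

definition weight :: "(nat \<times> nat) set \<Rightarrow> nat \<Rightarrow> (nat \<times> nat \<Rightarrow> nat) \<Rightarrow> ipoly" where
  "weight D n T = (\<Prod>i\<in>{1..n}. Var i ^ card {b \<in> D. T b = i})"

text \<open>The number \<open>i + c - k\<close> of the diagonal is the index of the generator
  removing the corner \<open>(i, k)\<close>. The restriction on the entries \<open>Suc n\<close>
  thus mirrors a row of generators starting at \<open>j\<close>.\<close>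

definition confined :: "nat \<Rightarrow> (nat \<times> nat) set \<Rightarrow> nat \<Rightarrow> nat \<Rightarrow> (nat \<times> nat \<Rightarrow> nat) set" where
  "confined c D n j = {T \<in> ssyt D (Suc n). \<forall>(i, k)\<in>D. T (i, k) = Suc n \<longrightarrow> j \<le> i + c - k}"

lemma skew_schur_weight: "skew_schur D n = (\<Sum>T\<in>ssyt D n. weight D n T)"
  by (simp add: skew_schur_def weight_def)

lemma ssyt_range: "T \<in> ssyt D n \<Longrightarrow> b \<in> D \<Longrightarrow> 1 \<le> T b \<and> T b \<le> n"
  by (auto simp: ssyt_def dest: PiE_mem)

lemma ssyt_row: "T \<in> ssyt D n \<Longrightarrow> (i, j) \<in> D \<Longrightarrow> (i, j') \<in> D \<Longrightarrow> j < j' \<Longrightarrow> T (i, j) \<le> T (i, j')"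
  by (auto simp: ssyt_def)

lemma ssyt_col: "T \<in> ssyt D n \<Longrightarrow> (i, j) \<in> D \<Longrightarrow> (i', j) \<in> D \<Longrightarrow> i < i' \<Longrightarrow> T (i, j) < T (i', j)"
  by (auto simp: ssyt_def)

lemma ssyt_undefined: "T \<in> ssyt D n \<Longrightarrow> b \<notin> D \<Longrightarrow> T b = undefined"
  by (auto simp: ssyt_def dest: PiE_arb)

lemma finite_ssyt: "finite D \<Longrightarrow> finite (ssyt D n)"
  unfolding ssyt_def by (rule finite_subset[OF _ finite_PiE[of D "\<lambda>_. {1..n}"]]) auto

lemma finite_confined: "finite D \<Longrightarrow> finite (confined c D n j)"
  unfolding confined_def using finite_ssyt by auto

lemma skew_boxes_iff: "(i, k) \<in> skew_boxes lam mu \<longleftrightarrow> 1 \<le> i \<and> mu i < k \<and> k \<le> lam i"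
  by (simp add: skew_boxes_def)

lemma skew_boxes_bounds:
  assumes "in_box r c lam" "(i, k) \<in> skew_boxes lam mu"
  shows "1 \<le> i" "i \<le> r" "1 \<le> k" "k \<le> c"
  using assms in_box_le[OF assms(1), of i] in_box_zero[OF assms(1), of i]
  by (force simp: skew_boxes_iff not_le[symmetric])+

lemma finite_skew_boxes:
  assumes "in_box r c lam"
  shows "finite (skew_boxes lam mu)"
proof (rule finite_subset)
  show "skew_boxes lam mu \<subseteq> {1..r} \<times> {1..c}"
    using skew_boxes_bounds[OF assms] by (auto simp del: One_nat_def)
qed simp

lemma weight_Suc:
  assumes "\<And>b. b \<in> D \<Longrightarrow> T b \<noteq> Suc n"
  shows "weight D (Suc n) T = weight D n T"
proof -
  have "{b \<in> D. T b = Suc n} = {}" using assms by blast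
  then have "card {b \<in> D. T b = Suc n} = 0" by (simp only: card.empty)
  then show ?thesis by (simp add: weight_def)
qed

text \<open>All boxes lie on earlier diagonals, so the entry \<open>Suc n\<close> cannot
  occur.\<close>

lemma sum_confined_max:
  assumes "\<And>i k. (i, k) \<in> D \<Longrightarrow> i + c - k < j"
  shows "(\<Sum>T\<in>confined c D n j. weight D (Suc n) T) = skew_schur D n"
proof -
  have ne: "T b \<noteq> Suc n" if "T \<in> confined c D n j" "b \<in> D" for T b
    using that assms[of "fst b" "snd b"] by (force simp: confined_def)
  have "confined c D n j = ssyt D n"
  proof
    show "confined c D n j \<subseteq> ssyt D n"
    proof
      fix T assume T: "T \<in> confined c D n j"
      then have T': "T \<in> ssyt D (Suc n)" by (simp add: confined_def)
      have "T b \<in> {1..n}" if "b \<in> D" for b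
        using ssyt_range[OF T' that] ne[OF T that] by auto
      with T' show "T \<in> ssyt D n" by (auto simp: ssyt_def PiE_iff)
    qed
    show "ssyt D n \<subseteq> confined c D n j"
    proof
      fix T assume T: "T \<in> ssyt D n"
      then have "T \<in> ssyt D (Suc n)" by (auto simp: ssyt_def PiE_iff)
      moreover have "T b \<noteq> Suc n" if "b \<in> D" for b using ssyt_range[OF T that] by auto
      ultimately show "T \<in> confined c D n j" by (auto simp: confined_def)
    qed
  qed
  then show ?thesis
    using ne by (auto simp: skew_schur_weight intro!: sum.cong weight_Suc)
qed

context
  fixes r c lam mu
  assumes lam: "in_box r c lam" and mu: "in_box r c mu"
begin

text \<open>A right neighbour would also carry \<open>Suc n\<close>, but on the forbidden diagonal
  \<open>j - 1\<close>; a box below would need a still larger entry.\<close>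

lemma confined_max_corner:
  assumes T: "T \<in> confined c (skew_boxes lam mu) n j" and D: "(i, k) \<in> skew_boxes lam mu"
    and max: "T (i, k) = Suc n" and j: "j = i + c - k"
  shows "corner lam i k"
proof -
  note b = skew_boxes_bounds[OF lam D]
  have ssyt: "T \<in> ssyt (skew_boxes lam mu) (Suc n)" using T by (simp add: confined_def)
  have "\<not> k < lam i"
  proof
    assume lt: "k < lam i"
    then have D': "(i, Suc k) \<in> skew_boxes lam mu" using D by (simp add: skew_boxes_iff)
    then have "T (i, Suc k) = Suc n"
      using ssyt_row[OF ssyt D D'] ssyt_range[OF ssyt D'] max by simp
    then have "j \<le> i + c - Suc k" using T D' by (auto simp: confined_def)
    \<comment> \<open>As \<open>k < lam i \<le> c\<close>, the subtraction is not truncated.\<close>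
    then show False using j in_box_le[OF lam b(1)] lt by simp
  qed
  then have k: "lam i = k" using D by (simp add: skew_boxes_iff)
  have "\<not> k \<le> lam (Suc i)"
  proof
    assume "k \<le> lam (Suc i)"
    then have D': "(Suc i, k) \<in> skew_boxes lam mu"
      using D in_box_antimono[OF mu b(1), of "Suc i"] by (auto simp: skew_boxes_iff)
    then show False
      using ssyt_col[OF ssyt D D'] ssyt_range[OF ssyt D'] max by simp
  qed
  then show ?thesis using b k by (simp add: corner_def)
qed

text \<open>Along a diagonal row and column grow together, whereas a lower corner cannot lie in a
  later column.\<close>

lemma corner_diagonal_unique:
  assumes "corner lam i k" "corner lam i' k'" "i + c - k = i' + c - k'"
  shows "i = i'" "k = k'"
proof -
  have "k \<le> c" "k' \<le> c" using corner_bounds[OF lam] assms by blast+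
  then have "i + k' = i' + k" using assms(3) by linarith
  moreover have "i' \<le> i \<Longrightarrow> k \<le> k'" "i \<le> i' \<Longrightarrow> k' \<le> k"
    using in_box_antimono[OF lam, of i' i] in_box_antimono[OF lam, of i i'] assms(1,2)
    by (auto simp: corner_def)
  ultimately show "i = i'" "k = k'" by linarith+
qed

lemma confined_Suc:
  "confined c (skew_boxes lam mu) n (Suc j) =
   {T \<in> confined c (skew_boxes lam mu) n j.
     \<forall>i k. (i, k) \<in> skew_boxes lam mu \<and> corner lam i k \<and> j = i + c - k \<longrightarrow> T (i, k) \<noteq> Suc n}"
  (is "?L = ?R")
proof
  show "?L \<subseteq> ?R" by (fastforce simp: confined_def)
  show "?R \<subseteq> ?L"
  proof
    fix T assume T: "T \<in> ?R"
    have "Suc j \<le> i + c - k" if D: "(i, k) \<in> skew_boxes lam mu" and max: "T (i, k) = Suc n" for i k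
    proof -
      have "j \<le> i + c - k" using T D max by (auto simp: confined_def)
      moreover have "j \<noteq> i + c - k"
        using confined_max_corner[where T = T, OF _ D max] T D max by blast
      ultimately show ?thesis by simp
    qed
    then show "T \<in> ?L" using T by (auto simp: confined_def)
  qed
qed

lemma confined_no_corner:
  assumes "\<not> (\<exists>i k. corner lam i k \<and> mu i < k \<and> j = i + c - k)"
  shows "confined c (skew_boxes lam mu) n j = confined c (skew_boxes lam mu) n (Suc j)"
  using assms unfolding confined_Suc by (auto simp: skew_boxes_iff)

lemma skew_boxes_remove_corner:
  assumes "corner lam i k"
  shows "skew_boxes (lam(i := k - 1)) mu = skew_boxes lam mu - {(i, k)}"
  using assms by (auto simp: skew_boxes_def corner_def split: if_splits)

text \<open>The tableaux are split by whether the only corner on diagonal \<open>j\<close> carries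
  \<open>Suc n\<close>. If it does, deleting its box is a bijection onto tableaux of the smaller
  shape and takes out one factor \<open>Var (Suc n)\<close>.\<close>

lemma sum_confined_corner:
  assumes cor: "corner lam i k" and k: "mu i < k" and j: "j = i + c - k"
  shows "(\<Sum>T\<in>confined c (skew_boxes lam mu) n j. weight (skew_boxes lam mu) (Suc n) T) =
    (\<Sum>T\<in>confined c (skew_boxes lam mu) n (Suc j). weight (skew_boxes lam mu) (Suc n) T) +
    Var (Suc n) * (\<Sum>T\<in>confined c (skew_boxes (lam(i := k - 1)) mu) n (Suc j).
      weight (skew_boxes (lam(i := k - 1)) mu) (Suc n) T)"
proof -
  define D where "D = skew_boxes lam mu"
  define D' where "D' = skew_boxes (lam(i := k - 1)) mu"
  define A where "A = {T \<in> confined c D n j. T (i, k) = Suc n}"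
  note bounds = corner_bounds[OF lam cor]
  have in_D: "(i, k) \<in> D" using bounds k by (simp add: D_def skew_boxes_iff)
  have D': "D' = D - {(i, k)}" using skew_boxes_remove_corner[OF cor] by (simp add: D_def D'_def)
  have fin: "finite D" using finite_skew_boxes[OF lam] by (simp add: D_def)
  have "corner lam x y \<and> j = x + c - y \<longleftrightarrow> x = i \<and> y = k" for x y
    using corner_diagonal_unique[OF cor, of x y] cor j by auto
  then have conf_Suc: "confined c D n (Suc j) = {T \<in> confined c D n j. T (i, k) \<noteq> Suc n}"
    using in_D unfolding D_def confined_Suc by auto
  have split: "confined c D n j = confined c D n (Suc j) \<union> A" "confined c D n (Suc j) \<inter> A = {}"
    unfolding conf_Suc A_def by blast+
  have below: "\<not> ((x, k) \<in> D \<and> i < x)" for x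
    using in_box_antimono[OF lam, of "Suc i" x] cor by (auto simp: D_def skew_boxes_iff corner_def)
  have right: "\<not> ((i, y) \<in> D \<and> k < y)" for y
    using bounds by (auto simp: D_def skew_boxes_iff)
  have bij: "bij_betw (\<lambda>T. restrict T D') A (confined c D' n (Suc j))"
  proof (rule bij_betwI[where g = "\<lambda>T. T((i, k) := Suc n)"])
    show "(\<lambda>T. restrict T D') \<in> A \<rightarrow> confined c D' n (Suc j)"
    proof
      fix T assume T: "T \<in> A"
      have ssyt: "T \<in> ssyt D (Suc n)" using T by (simp add: A_def confined_def)
      have "restrict T D' \<in> ssyt D' (Suc n)"
        using ssyt unfolding ssyt_def by (auto simp: D' PiE_iff)
      moreover have "Suc j \<le> x + c - y" if xy: "(x, y) \<in> D'" "T (x, y) = Suc n" for x y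
      proof -
        have "(x, y) \<in> D" "(x, y) \<noteq> (i, k)" using xy by (auto simp: D')
        moreover have "j \<le> x + c - y" using T xy by (auto simp: A_def confined_def D')
        \<comment> \<open>Another box with entry \<open>Suc n\<close> on diagonal \<open>j\<close>
          would be a second corner there.\<close>
        moreover have "j \<noteq> x + c - y"
        proof
          assume eq: "j = x + c - y"
          have "corner lam x y"
            using confined_max_corner[of T n j x y] T \<open>(x, y) \<in> D\<close> xy(2) eq by (simp add: A_def D_def)
          then show False
            using corner_diagonal_unique[OF cor, of x y] eq j \<open>(x, y) \<noteq> (i, k)\<close> by auto
        qed
        ultimately show ?thesis by simp
      qed
      ultimately show "restrict T D' \<in> confined c D' n (Suc j)"
        by (auto simp: confined_def)
    qed
    show "(\<lambda>T. T((i, k) := Suc n)) \<in> confined c D' n (Suc j) \<rightarrow> A"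
    proof
      fix T assume T: "T \<in> confined c D' n (Suc j)"
      then have ssyt: "T \<in> ssyt D' (Suc n)" by (simp add: confined_def)
      define T' where "T' = T((i, k) := Suc n)"
      have T'_eq: "T' b = (if b = (i, k) then Suc n else T b)" for b by (simp add: T'_def)
      have "T' \<in> D \<rightarrow>\<^sub>E {1..Suc n}"
        using ssyt in_D by (auto simp: T'_def ssyt_def D' PiE_iff extensional_def)
      moreover have "T' (x, y) \<le> T' (x, y')" if "(x, y) \<in> D" "(x, y') \<in> D" "y < y'" for x y y'
      proof (cases "(x, y) = (i, k)")
        case True
        then show ?thesis using right[of y'] that by auto
      next
        case False
        then have "(x, y) \<in> D'" using that by (simp add: D')
        then show ?thesis
          using ssyt_row[OF ssyt, of x y y'] ssyt_range[OF ssyt, of "(x, y)"] that False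
          by (auto simp: T'_eq D')
      qed
      moreover have "T' (x, y) < T' (x', y)" if "(x, y) \<in> D" "(x', y) \<in> D" "x < x'" for x x' y
      proof (cases "(x, y) = (i, k)")
        case True
        then show ?thesis using below[of x'] that by auto
      next
        case False
        then have xy: "(x, y) \<in> D'" using that by (simp add: D')
        show ?thesis
        proof (cases "(x', y) = (i, k)")
          case True
          \<comment> \<open>A box above the corner lies on an earlier diagonal, where
            \<open>T\<close> has no entry \<open>Suc n\<close>; so strictness down the column
            survives putting the box back.\<close>
          have "\<not> Suc j \<le> x + c - y" using True that j by auto
          then have "T (x, y) \<noteq> Suc n" using T xy by (auto simp: confined_def)
          then show ?thesis using ssyt_range[OF ssyt xy] False True by (simp add: T'_eq)
        next
          case neq: False
          then show ?thesis using ssyt_col[OF ssyt xy, of x'] that False by (auto simp: T'_eq D')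
        qed
      qed
      ultimately have "T' \<in> ssyt D (Suc n)" by (simp add: ssyt_def)
      moreover have "j \<le> x + c - y" if "(x, y) \<in> D" "T' (x, y) = Suc n" for x y
      proof (cases "(x, y) = (i, k)")
        case True
        then show ?thesis using j by simp
      next
        case False
        then have "(x, y) \<in> D'" "T (x, y) = Suc n" using that by (auto simp: D' T'_eq)
        then have "Suc j \<le> x + c - y" using T by (auto simp: confined_def)
        then show ?thesis by simp
      qed
      ultimately show "T' \<in> A" by (auto simp: A_def confined_def T'_eq)
    qed
    show "(restrict T D')((i, k) := Suc n) = T" if "T \<in> A" for T
    proof
      fix b
      have "T b = undefined" if "b \<notin> D"
        using \<open>T \<in> A\<close> ssyt_undefined[OF _ that] by (auto simp: A_def confined_def)
      then show "((restrict T D')((i, k) := Suc n)) b = T b"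
        using that by (auto simp: A_def D')
    qed
    show "restrict (T((i, k) := Suc n)) D' = T" if "T \<in> confined c D' n (Suc j)" for T
    proof
      fix b
      have "T b = undefined" if "b \<notin> D'"
        using \<open>T \<in> confined c D' n (Suc j)\<close> ssyt_undefined[OF _ that] by (auto simp: confined_def)
      then show "restrict (T((i, k) := Suc n)) D' b = T b"
        by (auto simp: D')
    qed
  qed
  have weight: "weight D (Suc n) T = Var (Suc n) * weight D' (Suc n) (restrict T D')" if "T \<in> A" for T
  proof -
    have "{b \<in> D. T b = a} = {b \<in> D'. restrict T D' b = a}" if "a \<noteq> Suc n" for a
      using \<open>T \<in> A\<close> that by (auto simp: A_def D')
    then have "(\<Prod>a\<in>{1..n}. Var a ^ card {b \<in> D. T b = a}) =
        (\<Prod>a\<in>{1..n}. Var a ^ card {b \<in> D'. restrict T D' b = a})"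
      by (intro prod.cong) auto
    moreover have "{b \<in> D. T b = Suc n} = insert (i, k) {b \<in> D'. restrict T D' b = Suc n}"
      using \<open>T \<in> A\<close> in_D by (auto simp: A_def D')
    moreover have "finite {b \<in> D'. restrict T D' b = Suc n}" "(i, k) \<notin> {b \<in> D'. restrict T D' b = Suc n}"
      using fin by (auto simp: D')
    ultimately show ?thesis
      by (simp add: weight_def mult_ac)
  qed
  have "(\<Sum>T\<in>A. weight D (Suc n) T) = (\<Sum>T\<in>A. Var (Suc n) * weight D' (Suc n) (restrict T D'))"
    using weight by (rule sum.cong[OF refl])
  also have "\<dots> = Var (Suc n) * (\<Sum>T\<in>confined c D' n (Suc j). weight D' (Suc n) T)"
    unfolding sum.reindex_bij_betw[OF bij, symmetric] by (simp add: sum_distrib_left)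
  finally show ?thesis
    unfolding D_def[symmetric] D'_def[symmetric] split(1)
    using split(2) finite_confined[OF fin] by (subst sum.union_disjoint) (auto simp: A_def)
qed

end

text \<open>Both sides obey the same recursion in \<open>j\<close>: the generator \<open>j\<close>
  removes the corner of diagonal \<open>j\<close> if there is one outside \<open>mu\<close>, and
  otherwise contributes nothing. Once the row is exhausted, \<open>f\<close> accounts for the
  entries up to \<open>n\<close>.\<close>

lemma row_skew_perm:
  assumes IH: "\<And>lam. in_box r c lam \<Longrightarrow> (\<And>i. 1 \<le> i \<Longrightarrow> mu i \<le> lam i) \<Longrightarrow>
      f (skew_perm r c lam mu) = skew_schur (skew_boxes lam mu) n"
    and mu: "in_box r c mu" and "in_box r c lam" "\<And>i. 1 \<le> i \<Longrightarrow> mu i \<le> lam i"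
    and "1 \<le> j" "j + l = r + c"
  shows "row j l (Var (Suc n)) f (skew_perm r c lam mu) =
    (\<Sum>T\<in>confined c (skew_boxes lam mu) n j. weight (skew_boxes lam mu) (Suc n) T)"
  using assms(3-)
proof (induction l arbitrary: j lam)
  case 0
  have "i + c - k < j" if "(i, k) \<in> skew_boxes lam mu" for i k
    using skew_boxes_bounds[OF 0(1) that] 0 by linarith
  then show ?case using IH[OF 0(1,2)] by (simp add: sum_confined_max)
next
  case (Suc l)
  note lam = Suc.prems(1)
  let ?w = "skew_perm r c lam mu" and ?S = "\<lambda>lam. \<Sum>T\<in>confined c (skew_boxes lam mu) n (Suc j).
      weight (skew_boxes lam mu) (Suc n) T"
  have rec: "row j (Suc l) (Var (Suc n)) f ?w = ?S lam +
      Var (Suc n) * nil j (row (Suc j) l (Var (Suc n)) f) ?w"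
    using Suc.IH[of lam "Suc j"] Suc.prems by (simp add: fac_def)
  show ?case
  proof (cases "\<exists>i k. corner lam i k \<and> mu i < k \<and> j = i + c - k")
    case True
    then obtain i k where ik: "corner lam i k" "mu i < k" "j = i + c - k" by blast
    let ?lam = "lam(i := k - 1)"
    have "row (Suc j) l (Var (Suc n)) f (skew_perm r c ?lam mu) = ?S ?lam"
      using Suc.prems ik by (intro Suc.IH in_box_remove_corner) auto
    then have "nil j (row (Suc j) l (Var (Suc n)) f) ?w = ?S ?lam"
      using skew_perm_descent[OF lam mu ik(1,2)] skew_perm_remove_corner[OF lam ik(1), of mu] ik(3)
      by (simp add: nil_def)
    then show ?thesis
      unfolding rec by (simp only: sum_confined_corner[OF lam mu ik])
  next
    case False
    then have "\<not> ?w j > ?w (j + 1)"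
      using skew_perm_descentD[OF lam mu Suc.prems(2,3)] Suc.prems(4) by auto
    then have "nil j (row (Suc j) l (Var (Suc n)) f) ?w = 0"
      by (simp add: nil_def)
    then show ?thesis
      unfolding rec by (simp only: confined_no_corner[OF lam mu False] mult_zero_right add_0_right)
  qed
qed

lemma stanley_skew_perm:
  assumes mu: "in_box r c mu" and "in_box r c lam" "\<And>i. 1 \<le> i \<Longrightarrow> mu i \<le> lam i" and rc: "1 \<le> r + c"
  shows "stanley (r + c) n (skew_perm r c lam mu) = skew_schur (skew_boxes lam mu) n"
  using assms(2,3)
proof (induction n arbitrary: lam)
  case 0
  show ?case
  proof (cases "skew_boxes lam mu = {}")
    case True
    have "lam i = mu i" if "1 \<le> i" for i
      using True 0(2)[OF that] that skew_boxes_iff[of i "lam i" lam mu] by auto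
    then have "skew_perm r c lam mu = id" using skew_perm_eq_id_iff[OF 0(1) mu] by blast
    moreover have "ssyt (skew_boxes lam mu) 0 = {\<lambda>_. undefined}"
      using True by (simp add: ssyt_def)
    ultimately show ?thesis by (simp only: stanley.simps delta_def skew_schur_def) simp
  next
    case False
    then obtain i k where ik: "(i, k) \<in> skew_boxes lam mu" by auto
    then have "lam i \<noteq> mu i" "1 \<le> i" by (auto simp: skew_boxes_iff)
    then have "skew_perm r c lam mu \<noteq> id" using skew_perm_eq_id_iff[OF 0(1) mu] by blast
    moreover have "ssyt (skew_boxes lam mu) 0 = {}"
      using ssyt_range[OF _ ik, of _ 0] by fastforce
    ultimately show ?thesis by (simp only: stanley.simps delta_def skew_schur_def) simp
  qed
next
  case (Suc n)
  let ?D = "skew_boxes lam mu"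
  have "stanley (r + c) (Suc n) (skew_perm r c lam mu) =
      (\<Sum>T\<in>confined c ?D n 1. weight ?D (Suc n) T)"
    unfolding stanley.simps by (rule row_skew_perm) (use Suc mu rc in auto)
  \<comment> \<open>Every box has \<open>1 \<le> i\<close> and \<open>k \<le> c\<close>, so its
    diagonal number is at least 1.\<close>
  also have "confined c ?D n 1 = ssyt ?D (Suc n)"
    using skew_boxes_bounds[OF Suc.prems(1)] by (fastforce simp: confined_def)
  finally show ?case by (simp only: skew_schur_weight)
qed

section \<open>Choice of the box and conclusion\<close>

lemma partition_in_box:
  assumes "is_partition lam"
  shows "\<exists>r0. \<forall>r\<ge>r0. \<forall>c\<ge>lam 1. in_box r c lam"
proof -
  have anti: "antimono_on {1..} lam" and fin: "finite {i. 1 \<le> i \<and> lam i \<noteq> 0}"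
    using assms by (auto simp: is_partition_def)
  obtain r0 where r0: "\<forall>i\<in>{i. 1 \<le> i \<and> lam i \<noteq> 0}. i \<le> r0"
    using fin finite_nat_set_iff_bounded_le by blast
  have "in_box r c lam" if "r0 \<le> r" "lam 1 \<le> c" for r c
  proof -
    have "lam i = 0" if "i > r" for i proof (rule ccontr)
      assume "lam i \<noteq> 0"
      then have "i \<le> r0" using r0 that by auto
      then show False using that \<open>r0 \<le> r\<close> by simp
    qed
    moreover have "lam i \<le> lam 1" if "1 \<le> i" for i
      using anti that by (auto elim!: monotone_onD)
    ultimately show ?thesis
      using anti that by (auto simp: in_box_def intro: order_trans)
  qed
  then show ?thesis by blast
qed

theorem proposition2p3:
  fixes D :: "(nat \<times> nat) set" and n :: nat
  assumes "is_skew_shape D" and "n \<ge> 1"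
  shows "\<exists>p m0 w. p \<ge> 1 \<and> m0 \<ge> 1 \<and> w permutes {1..p} \<and> avoids_321 p w \<and>
           (\<forall>m\<ge>m0. n \<le> m + p - 1 \<and>
              skew_schur D n =
                subst (\<lambda>i. if 1 \<le> i \<and> i \<le> n then Var i else 0)
                  (schubert (m + p) (perm_times m id w)))"
proof -
  obtain lam mu where part: "is_partition lam" "is_partition mu"
    and le: "\<And>i. 1 \<le> i \<Longrightarrow> mu i \<le> lam i" and D: "D = skew_boxes lam mu"
    using assms(1) by (auto simp: is_skew_shape_def)
  obtain r1 r2 where r1: "\<And>r c. r1 \<le> r \<Longrightarrow> lam 1 \<le> c \<Longrightarrow> in_box r c lam"
    and r2: "\<And>r c. r2 \<le> r \<Longrightarrow> mu 1 \<le> c \<Longrightarrow> in_box r c mu"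
    using partition_in_box[OF part(1)] partition_in_box[OF part(2)] by blast
  \<comment> \<open>The successor keeps \<open>p = r + c\<close> positive even for empty
    partitions.\<close>
  define r where "r = Suc (max r1 r2)"
  define c where "c = lam 1"
  define w where "w = skew_perm r c lam mu"
  have lam: "in_box r c lam" and mu: "in_box r c mu"
    using r1 r2 le[of 1] by (auto simp: r_def c_def)
  have rc: "1 \<le> r + c" by (simp add: r_def)
  have w: "w permutes {1..r + c}"
    unfolding w_def by (rule skew_perm_permutes[OF lam mu])
  have "subst (\<lambda>i. if 1 \<le> i \<and> i \<le> n then Var i else 0) (schubert (m + (r + c)) (perm_times m id w)) =
      skew_schur D n" if "n \<le> m" for m
    unfolding subst_schubert_stable[OF w rc that] unfolding w_def D
    by (rule stanley_skew_perm[OF mu lam le rc])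
  moreover have "avoids_321 (r + c) w"
    unfolding w_def by (rule skew_perm_avoids_321[OF lam mu])
  moreover have "n \<le> m + (r + c) - 1" if "n \<le> m" for m
    using that rc by simp
  ultimately show ?thesis
    using w rc assms(2) by (intro exI[of _ "r + c"] exI[of _ n] exI[of _ w]) simp
qed

end
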